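(* Let $P:\mathbb{R}^n\to\mathbb{R}^n$ be a self-adjoint nonexpansive linear operator, let $q\in\mathbb{R}^n$, and let $f_1(x)=\tfrac12\langle Px,x\rangle+\langle q,x\rangle$, so that $\nabla f_1(x)=Px+q$. Let $f_2:\mathbb{R}^n\to\mathbb{R}$ be differentiable with $\nabla f_2$ nonexpansive. Let $F(x)=\tfrac12\langle Px,x\rangle-f_2(\nabla f_1(x))$. Then $\nabla F$ is $2$-Lipschitz continuous, i.e. $$\|\nabla F(x)-\nabla F(y)\|\le 2\|x-y\|\qquad\text{for all }x,y\in\mathbb{R}^n.$$
   Context: $\langle\cdot,\cdot\rangle$ is an inner product on $\mathbb{R}^n$ with induced norm $\|\cdot\|$; gradients and adjoints are taken with respect to it. A mapping $T:\mathbb{R}^n\to\mathbb{R}^n$ is nonexpansive if $\|Tx-Ty\|\le\|x-y\|$ for all $x,y$. *)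

theory Defs
  imports "HOL-Analysis.Analysis"
begin

text \<open>
  Euclidean space with an arbitrary inner product is rendered by the class \<open>euclidean_space\<close>,
  whose \<open>inner\<close> is abstract; \<open>norm\<close>, \<open>adjoint\<close> and \<open>GDERIV\<close> all refer to it.
\<close>

definition nonexpansive :: "('a::real_normed_vector \<Rightarrow> 'a) \<Rightarrow> bool" where
  "nonexpansive T \<longleftrightarrow> (\<forall>x y. norm (T x - T y) \<le> norm (x - y))"

text \<open>Meaningful only at points where \<open>f\<close> is differentiable.\<close>

definition gradient :: "('a::real_inner \<Rightarrow> real) \<Rightarrow> 'a \<Rightarrow> 'a" where
  "gradient f x = (THE D. GDERIV f x :> D)"

lemma gradient_eqI:
  assumes "GDERIV f x :> D"
  shows "gradient f x = D"
  unfolding gradient_def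
proof (rule the_equality)
  fix D' assume "GDERIV f x :> D'"
  then have "(\<lambda>h. inner h D') = (\<lambda>h. inner h D)"
    using assms unfolding gderiv_def by (rule has_derivative_unique)
  then have "inner h D' = inner h D" for h
    by (rule fun_cong)
  then show "D' = D"
    using vector_eq_ldot by blast
qed (fact assms)

lemma differentiable_imp_GDERIV_gradient:
  fixes f :: "'a::euclidean_space \<Rightarrow> real"
  assumes "f differentiable (at x)"
  shows "GDERIV f x :> gradient f x"
proof -
  obtain f' where f': "(f has_derivative f') (at x)"
    using assms unfolding differentiable_def by blast
  then have lin: "linear f'"
    by (rule has_derivative_linear)
  have "f' = (\<lambda>h. inner h (adjoint f' 1))"
  proof
    show "f' h = inner h (adjoint f' 1)" for h
      using adjoint_works[OF lin, of h 1] by simp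
  qed
  with f' have "(f has_derivative (\<lambda>h. inner h (adjoint f' 1))) (at x)"
    by (rule back_subst[where P = "\<lambda>g. (f has_derivative g) (at x)"])
  then have D: "GDERIV f x :> adjoint f' 1"
    unfolding gderiv_def .
  show ?thesis
    unfolding gradient_eqI[OF D] by (fact D)
qed

end

theory Submission imports Defs begin

text \<open>With \<open>g\<close> the gradient of \<open>f2\<close>, the chain rule and
  self-adjointness of \<open>P\<close> give the gradient of \<open>F\<close> at \<open>x\<close> as
  \<open>P (x - g (P x + q))\<close>. A difference of two such gradients is therefore
  \<open>P\<close> applied to the difference of the points minus the difference of the values of
  \<open>g\<close>. The outer \<open>P\<close> does not increase norms, and each of the two
  differences has norm at most \<open>norm (x - y)\<close>, whence the constant 2. The gradient
  formula rests on \<open>GDERIV_quadratic_form\<close> and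
  \<open>GDERIV_compose_affine\<close>.\<close>

lemma GDERIV_quadratic_form:
  fixes P :: "'a::euclidean_space \<Rightarrow> 'a"
  assumes "linear P" "adjoint P = P"
  shows "GDERIV (\<lambda>x. 1/2 * inner (P x) x) x :> P x"
proof -
  have bl: "bounded_linear P"
    using assms(1) by (simp add: linear_conv_bounded_linear)
  have sym: "inner (P a) b = inner a (P b)" for a b
    using adjoint_works[OF assms(1), of a b] assms(2) by simp
  have "((\<lambda>x. 1/2 * inner (P x) x) has_derivative
      (\<lambda>h. 1/2 * (inner (P x) h + inner (P h) x))) (at x)"
    by (intro has_derivative_mult_right has_derivative_inner has_derivative_ident
        bounded_linear.has_derivative[OF bl])
  \<comment> \<open>Symmetry makes the two terms of the product rule equal, which absorbs the factor
    1/2.\<close>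
  moreover have "1/2 * (inner (P x) h + inner (P h) x) = inner h (P x)" for h
    using sym[of h x] inner_commute[of "P x" h] by simp
  ultimately show ?thesis
    unfolding gderiv_def by simp
qed

text \<open>The derivative of the composition at \<open>h\<close> is \<open>inner (P h) D\<close>;
  the adjoint moves \<open>P\<close> onto \<open>D\<close>, turning this functional into a
  gradient.\<close>

lemma GDERIV_compose_affine:
  fixes P :: "'a::euclidean_space \<Rightarrow> 'a"
  assumes "linear P" "GDERIV f (P x + q) :> D"
  shows "GDERIV (\<lambda>x. f (P x + q)) x :> adjoint P D"
proof -
  have bl: "bounded_linear P"
    using assms(1) by (simp add: linear_conv_bounded_linear)
  have "((\<lambda>x. P x + q) has_derivative P) (at x)"
    using has_derivative_add_const bounded_linear_imp_has_derivative[OF bl] by blast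
  from has_derivative_compose[OF this assms(2)[unfolded gderiv_def]]
  show ?thesis
    unfolding gderiv_def adjoint_works[OF assms(1)] .
qed

lemma linear_nonexpansive_norm_le:
  assumes "linear P" "nonexpansive P"
  shows "norm (P x) \<le> norm x"
  using assms(2)[unfolded nonexpansive_def, rule_format, of x 0] linear_0[OF assms(1)] by simp

theorem proposition3p1:
  fixes P :: "'a::euclidean_space \<Rightarrow> 'a"
    and q :: 'a
    and f1 f2 F :: "'a \<Rightarrow> real"
  assumes "linear P"
    and "adjoint P = P"
    and "nonexpansive P"
    and f1_eq: "\<And>x. f1 x = 1/2 * inner (P x) x + inner q x"
    and "\<And>x. f2 differentiable (at x)"
    and "nonexpansive (gradient f2)"
    and F_eq: "\<And>x. F x = 1/2 * inner (P x) x - f2 (gradient f1 x)"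
  shows "(\<forall>x. GDERIV f1 x :> P x + q) \<and>
         (\<forall>x. F differentiable (at x)) \<and>
         (\<forall>x y. norm (gradient F x - gradient F y) \<le> 2 * norm (x - y))"
proof -
  note quad = GDERIV_quadratic_form[OF assms(1,2)]
  have "GDERIV (\<lambda>x. inner q x) x :> q" for x
    unfolding gderiv_def inner_commute[of q]
    by (intro has_derivative_inner_left has_derivative_ident)
  from GDERIV_add[OF quad this] have f1': "GDERIV f1 x :> P x + q" for x
    by (simp add: f1_eq[abs_def])
  define g where "g = gradient f2"
  \<comment> \<open>Replacing the gradient of \<open>f1\<close> by its explicit affine form brings
    \<open>F\<close> into the shape the chain rule needs.\<close>
  have F_eq': "F = (\<lambda>x. 1/2 * inner (P x) x - f2 (P x + q))"
    by (rule ext) (simp only: F_eq gradient_eqI[OF f1'])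
  have "GDERIV (\<lambda>x. f2 (P x + q)) x :> P (g (P x + q))" for x
    using GDERIV_compose_affine[OF assms(1) differentiable_imp_GDERIV_gradient[OF assms(5)]]
    unfolding assms(2) g_def .
  from GDERIV_diff[OF quad this]
  have F': "GDERIV F x :> P x - P (g (P x + q))" for x
    unfolding F_eq' .
  have "norm (gradient F x - gradient F y) \<le> 2 * norm (x - y)" for x y
  proof -
    let ?d = "g (P x + q) - g (P y + q)"
    \<comment> \<open>Linearity gathers everything under a single \<open>P\<close>, and
      \<open>q\<close> survives only inside \<open>g\<close>.\<close>
    have "gradient F x - gradient F y = P ((x - y) - ?d)"
      by (simp add: gradient_eqI[OF F'] linear_diff[OF assms(1)])
    then have "norm (gradient F x - gradient F y) \<le> norm ((x - y) - ?d)"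
      by (simp only: linear_nonexpansive_norm_le[OF assms(1,3)])
    also have "\<dots> \<le> norm (x - y) + norm ?d"
      by (rule norm_triangle_ineq4)
    \<comment> \<open>The map \<open>g\<close> is evaluated at the images of \<open>x\<close> and
      \<open>y\<close> under a nonexpansive affine map, so \<open>?d\<close> contributes the second
      \<open>norm (x - y)\<close>.\<close>
    also have "norm ?d \<le> norm ((P x + q) - (P y + q))"
      using assms(6) unfolding nonexpansive_def g_def by blast
    also have "\<dots> \<le> norm (x - y)"
      using assms(3) unfolding nonexpansive_def by simp
    finally show ?thesis by simp
  qed
  moreover have "F differentiable (at x)" for x
    using F' unfolding gderiv_def differentiable_def by blast
  ultimately show ?thesis
    using f1' by blast
qed

end
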